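(* Let $n$ be a positive even integer. Among all directed $2$-regular graphs $G$ on $n$ vertices, the expected number of cycles $\mathbb{E}\,c(\sigma)$ of a uniformly random cycle-factor $\sigma\in\mathcal{C}(G)$ is uniquely maximised (up to isomorphism of $G$), with value $$\frac n2 H_2=\frac{3n}{4},$$ by the disjoint union of $n/2$ copies of $K_2^\circ$.
   Context: Directed graphs are finite, may have loops and directed cycles of length two, but have no parallel edges (for each ordered pair $(u,v)$, possibly with $u=v$, there is at most one edge $u\to v$). A loop contributes one to both the in-degree and the out-degree of its vertex. A directed graph is $d$-regular if every vertex has in-degree and out-degree exactly $d$. A cycle-factor of a directed graph $G$ is a permutation $\sigma$ of $V(G)$ such that $v\to\sigma(v)$ is an edge of $G$ for every $v\in V(G)$. $\mathcal{C}(G)$ denotes the set of cycle-factors of $G$, and $c(\sigma)$ is the number of cycles of the permutation $\sigma$, fixed points included. $K_2^\circ$ is the complete looped digraph on $2$ vertices: all four ordered pairs $(u,v)$, including $u=v$, are edges. $H_m=\sum_{j=1}^m\frac1j$. *)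

theory Defs
  imports
    "HOL-Probability.Probability"
    "HOL-Combinatorics.Orbits"
    "Graph_Theory.Graph_Theory"
begin

text \<open>
  Directed graphs are pair digraphs: arcs are ordered pairs of vertices, so there are no
  parallel arcs, while loops and directed 2-cycles are allowed. A loop \<open>(v, v)\<close> lies in both
  the in-arcs and the out-arcs of \<open>v\<close>.
\<close>

definition regular_digraph :: "nat \<Rightarrow> 'a pair_pre_digraph \<Rightarrow> bool" where
  "regular_digraph d G \<longleftrightarrow> pair_fin_digraph G \<and>
     (\<forall>v\<in>pverts G. in_degree (with_proj G) v = d \<and> out_degree (with_proj G) v = d)"

text \<open>
  A permutation of the vertex set is extended by the identity to the whole vertex type
  (\<open>permutes\<close>), so distinct cycle-factors are distinct functions.
\<close>

definition cycle_factors :: "'a pair_pre_digraph \<Rightarrow> ('a \<Rightarrow> 'a) set" where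
  "cycle_factors G = {\<sigma>. \<sigma> permutes pverts G \<and> (\<forall>v\<in>pverts G. (v, \<sigma> v) \<in> parcs G)}"

definition num_cycles :: "'a set \<Rightarrow> ('a \<Rightarrow> 'a) \<Rightarrow> nat" where
  "num_cycles V \<sigma> = card (orbit \<sigma> ` V)"

text \<open>
  The uniform distribution \<open>pmf_of_set\<close> is meaningful only on a finite nonempty set. Every
  finite \<open>d\<close>-regular digraph with \<open>d > 0\<close> has a cycle-factor, by Hall's theorem applied to its
  bipartite double cover.
\<close>

definition expected_cycles :: "'a pair_pre_digraph \<Rightarrow> real" where
  "expected_cycles G =
     measure_pmf.expectation (pmf_of_set (cycle_factors G)) (\<lambda>\<sigma>. real (num_cycles (pverts G) \<sigma>))"

definition complete_looped :: "nat \<Rightarrow> nat pair_pre_digraph" where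
  "complete_looped d = \<lparr> pverts = {..<d}, parcs = {..<d} \<times> {..<d} \<rparr>"

definition disjoint_copies :: "nat \<Rightarrow> 'a pair_pre_digraph \<Rightarrow> (nat \<times> 'a) pair_pre_digraph" where
  "disjoint_copies k G =
     \<lparr> pverts = {..<k} \<times> pverts G,
       parcs = {((i, u), (i, v)) | i u v. i < k \<and> (u, v) \<in> parcs G} \<rparr>"

end

theory Submission
  imports Defs
begin

text \<open>
  Every vertex of a \<open>2\<close>-regular digraph has exactly two out-arcs, and a cycle-factor \<open>\<sigma>\<close> uses
  one of them. Letting every vertex use the one that \<open>\<sigma>\<close> leaves out gives again a cycle-factor,
  the opposite of \<open>\<sigma>\<close>: every vertex has two in-arcs, \<open>\<sigma>\<close> uses exactly one of them, so the
  opposite uses exactly the other one. Taking opposites is an involution on the cycle-factors,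
  hence \<open>2 * expected_cycles G\<close> is the average of \<open>c(\<sigma>) + c(\<sigma>')\<close>, where \<open>\<sigma>'\<close> is the opposite
  of \<open>\<sigma>\<close>, and a bound on this sum for each single \<open>\<sigma>\<close> is enough.

  Charging each vertex \<open>1 / l\<close>, where \<open>l\<close> is the length of its cycle, counts the cycles
  (\<open>num_cycles_eq_sum\<close>). As \<open>\<sigma>\<close> and \<open>\<sigma>'\<close> differ everywhere, no vertex is fixed by both, so it
  contributes at most \<open>1 + 1/2\<close> to \<open>c(\<sigma>) + c(\<sigma>')\<close>. This gives \<open>3n/4\<close>. Equality forces each
  vertex to be a fixed point of one of the two and to lie on a \<open>2\<close>-cycle of the other. So every
  vertex has a loop, and its other out-arc is reversible; for a \<open>2\<close>-regular digraph this means
  that the arc relation is an equivalence relation, and conversely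
  (\<open>num_cycles_add_opposite\<close>). The classes then have two elements, and the digraph is a disjoint
  union of complete looped digraphs on two vertices (\<open>equiv_regular_iff_iso\<close>).

  The average makes sense only if there is a cycle-factor at all. Cycle-factors are perfect
  matchings of the bipartite double cover, whose components are even cycles, so that taking
  alternate edges works (\<open>ex_alternating_set\<close>, \<open>cycle_factors_nonempty\<close>).
\<close>

section \<open>Regular digraphs and two-element sets\<close>

lemma regular_digraph_iff:
  "regular_digraph d G \<longleftrightarrow> finite (pverts G) \<and> parcs G \<subseteq> pverts G \<times> pverts G
     \<and> (\<forall>v\<in>pverts G. card (parcs G `` {v}) = d \<and> card ((parcs G)\<inverse> `` {v}) = d)"
proof -
  have out: "out_degree (with_proj G) v = card (parcs G `` {v})" for v
  proof -
    have "out_arcs (with_proj G) v = Pair v ` (parcs G `` {v})"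
      by (auto simp: out_arcs_def)
    then show ?thesis
      by (simp add: out_degree_def card_image inj_on_def)
  qed
  have indeg: "in_degree (with_proj G) v = card ((parcs G)\<inverse> `` {v})" for v
  proof -
    have "in_arcs (with_proj G) v = (\<lambda>u. (u, v)) ` ((parcs G)\<inverse> `` {v})"
      by (auto simp: in_arcs_def)
    then show ?thesis
      by (simp add: in_degree_def card_image inj_on_def)
  qed
  have "pair_fin_digraph G \<longleftrightarrow> finite (pverts G) \<and> parcs G \<subseteq> pverts G \<times> pverts G"
    by (auto simp: pair_fin_digraph_def pair_wf_digraph_def pair_fin_digraph_axioms_def
        intro: finite_subset)
  then show ?thesis
    by (auto simp: regular_digraph_def out indeg)
qed

text \<open>Intended for two-element sets \<open>S\<close> that contain \<open>x\<close>.\<close>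

definition other :: "'a set \<Rightarrow> 'a \<Rightarrow> 'a" where
  "other S x = (SOME y. y \<in> S \<and> y \<noteq> x)"

lemma other_eq_iff:
  assumes "card S = 2" "x \<in> S"
  shows "y = other S x \<longleftrightarrow> y \<in> S \<and> y \<noteq> x"
proof -
  obtain a b where "S = {a, b}" "a \<noteq> b"
    using assms(1) by (auto simp: card_2_iff)
  with assms(2) have ex1: "\<exists>!y. y \<in> S \<and> y \<noteq> x"
    by auto
  have other: "other S x \<in> S \<and> other S x \<noteq> x"
    unfolding other_def by (rule someI_ex) (use ex1 in blast)
  show ?thesis
  proof
    assume "y \<in> S \<and> y \<noteq> x"
    with ex1 other show "y = other S x"
      by metis
  qed (simp add: other)
qed

lemma other_props:
  assumes "card S = 2" "x \<in> S"
  shows "other S x \<in> S" "other S x \<noteq> x" "other S (other S x) = x" "S = {x, other S x}"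
proof -
  show *: "other S x \<in> S" "other S x \<noteq> x"
    using other_eq_iff[OF assms, of "other S x"] by simp_all
  show "other S (other S x) = x"
    using other_eq_iff[OF assms(1) *(1), of x] *(2) assms(2) by simp
  show "S = {x, other S x}"
    using other_eq_iff[OF assms] * assms(2) by blast
qed

section \<open>Existence of a cycle-factor\<close>

text \<open>
  View \<open>\<alpha>\<close> and \<open>\<beta>\<close> as two perfect matchings on \<open>A\<close>: their union consists of even cycles, and
  \<open>S\<close> takes every second point on each. The two halves of such a cycle are orbits of
  \<open>\<gamma> = \<alpha> \<circ> \<beta>\<close>, which walks along the cycle two steps at a time. Since \<open>\<alpha>\<close> and \<open>\<beta>\<close> conjugate \<open>\<gamma>\<close>
  to its inverse, both map \<open>\<gamma>\<close>-orbits to \<open>\<gamma>\<close>-orbits, and it remains to see that they exchange the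
  two halves, that is, that \<open>\<alpha> x\<close> is never in the orbit of \<open>x\<close>.
\<close>

lemma ex_alternating_set:
  fixes \<alpha> \<beta> :: "'a \<Rightarrow> 'a"
  assumes fin: "finite A"
    and perm: "\<alpha> permutes A" "\<beta> permutes A"
    and invol: "\<And>x. \<alpha> (\<alpha> x) = x" "\<And>x. \<beta> (\<beta> x) = x"
    and nofix: "\<And>x. x \<in> A \<Longrightarrow> \<alpha> x \<noteq> x" "\<And>x. x \<in> A \<Longrightarrow> \<beta> x \<noteq> x"
  obtains S where "\<And>x. x \<in> A \<Longrightarrow> \<alpha> x \<in> S \<longleftrightarrow> x \<notin> S" "\<And>x. x \<in> A \<Longrightarrow> \<beta> x \<in> S \<longleftrightarrow> x \<notin> S"
proof -
  define \<gamma> where "\<gamma> = \<alpha> \<circ> \<beta>"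
  have \<gamma>_perm: "\<gamma> permutes A"
    unfolding \<gamma>_def using perm by (simp add: permutes_compose)
  then have \<gamma>: "permutation \<gamma>"
    using fin by (auto simp: permutation_permutes)
  have inv_\<gamma>: "inv \<gamma> = \<beta> \<circ> \<alpha>"
    by (rule inv_unique_comp) (auto simp: \<gamma>_def fun_eq_iff invol)
  have orbit_\<alpha>: "orbit \<gamma> (\<alpha> x) = \<alpha> ` orbit \<gamma> x" for x
  proof -
    have "\<alpha> ` orbit \<gamma> x = orbit (inv \<gamma>) (\<alpha> x)"
      by (rule orbit_inverse[OF permutation_self_in_orbit[OF \<gamma>]])
        (simp add: inv_\<gamma>, simp add: \<gamma>_def invol)
    then show ?thesis
      by (simp add: orbit_inv_eq[OF \<gamma>])
  qed
  have orbit_\<beta>: "orbit \<gamma> (\<beta> x) = orbit \<gamma> (\<alpha> x)" for x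
  proof -
    have "\<beta> x = \<alpha> (\<gamma> x)"
      by (simp add: \<gamma>_def invol)
    then show ?thesis
      by (simp add: orbit_\<alpha> permutation_orbit_step[OF \<gamma>])
  qed
  \<comment> \<open>If \<open>\<alpha> x\<close> were \<open>n\<close> steps of \<open>\<gamma>\<close> away from \<open>x\<close>, then \<open>\<alpha> (\<gamma> x)\<close> would be \<open>n - 2\<close> steps away from
    \<open>\<gamma> x\<close>; this ends in a fixed point of \<open>\<alpha>\<close> (\<open>n\<close> even) or of \<open>\<beta>\<close> (\<open>n\<close> odd).\<close>
  have separated: "(\<gamma> ^^ n) x \<noteq> \<alpha> x" if "x \<in> A" for n x
    using that
  proof (induction n arbitrary: x rule: induct_nat_012)
    case 0
    then show ?case using nofix(1)[of x] by auto
  next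
    case 1
    then show ?case using nofix(2)[of x] invol(1) by (auto simp: \<gamma>_def) metis
  next
    case (ge2 n)
    show ?case
    proof
      assume eq: "(\<gamma> ^^ Suc (Suc n)) x = \<alpha> x"
      have "\<gamma> ((\<gamma> ^^ n) (\<gamma> x)) = \<alpha> x"
        using eq by (simp add: funpow_swap1)
      then have "(\<gamma> ^^ n) (\<gamma> x) = \<beta> x"
        by (metis \<gamma>_def comp_apply invol)
      also have "\<dots> = \<alpha> (\<gamma> x)"
        by (simp add: \<gamma>_def invol)
      finally show False
        using ge2.IH(1)[of "\<gamma> x"] ge2.prems permutes_in_image[OF \<gamma>_perm] by simp
    qed
  qed
  have disj: "orbit \<gamma> x \<inter> orbit \<gamma> (\<alpha> x) = {}" if "x \<in> A" for x
  proof (rule ccontr)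
    assume "\<not> ?thesis"
    then obtain z where "z \<in> orbit \<gamma> x" "z \<in> orbit \<gamma> (\<alpha> x)"
      by blast
    then have "orbit \<gamma> x = orbit \<gamma> (\<alpha> x)"
      using orbit_cyclic_eq3[OF cyclic_on_orbit'[OF \<gamma>]] by blast
    then have "\<alpha> x \<in> orbit \<gamma> x"
      using permutation_self_in_orbit[OF \<gamma>] by blast
    then show False
      using separated[OF that] unfolding orbit_altdef by force
  qed
  \<comment> \<open>The choice depends only on the union of the two halves, so all points of a cycle agree on it.\<close>
  define rep where "rep x = (SOME z. z \<in> orbit \<gamma> x \<union> orbit \<gamma> (\<alpha> x))" for x
  have rep_in: "rep x \<in> orbit \<gamma> x \<union> orbit \<gamma> (\<alpha> x)" for x
    unfolding rep_def by (rule someI_ex) (use permutation_self_in_orbit[OF \<gamma>] in blast)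
  have rep_\<alpha>: "rep (\<alpha> x) = rep x" for x
    by (simp add: rep_def invol Un_commute)
  have rep_\<beta>: "rep (\<beta> x) = rep x" for x
    by (simp add: rep_def orbit_\<beta> orbit_\<alpha> image_image invol Un_commute)
  define S where "S = {x. rep x \<in> orbit \<gamma> x}"
  show thesis
  proof (rule that)
    fix x assume "x \<in> A"
    show "\<alpha> x \<in> S \<longleftrightarrow> x \<notin> S"
      using rep_in[of x] disj[OF \<open>x \<in> A\<close>] by (auto simp: S_def rep_\<alpha>)
    show "\<beta> x \<in> S \<longleftrightarrow> x \<notin> S"
      using rep_in[of x] disj[OF \<open>x \<in> A\<close>] by (auto simp: S_def rep_\<beta> orbit_\<beta>)
  qed
qed

text \<open>
  On the arcs, let \<open>\<alpha>\<close> exchange the two arcs with a common tail and \<open>\<beta>\<close> the two arcs with a common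
  head. A set of arcs alternating under \<open>\<alpha>\<close> contains one out-arc at each vertex, hence is the
  graph of a function, and alternating under \<open>\<beta>\<close> makes this function injective.
\<close>

lemma cycle_factors_nonempty:
  assumes "regular_digraph 2 G"
  shows "cycle_factors G \<noteq> {}"
proof -
  let ?V = "pverts G" and ?E = "parcs G"
  have fin: "finite ?V" and sub: "?E \<subseteq> ?V \<times> ?V"
    and out: "\<And>v. v \<in> ?V \<Longrightarrow> card (?E `` {v}) = 2"
    and indeg: "\<And>v. v \<in> ?V \<Longrightarrow> card (?E\<inverse> `` {v}) = 2"
    using assms by (auto simp: regular_digraph_iff)
  define \<alpha> where "\<alpha> e = (if e \<in> ?E then (fst e, other (?E `` {fst e}) (snd e)) else e)" for e
  define \<beta> where "\<beta> e = (if e \<in> ?E then (other (?E\<inverse> `` {snd e}) (fst e), snd e) else e)" for e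
  have \<alpha>: "(u, other (?E `` {u}) v) \<in> ?E" "other (?E `` {u}) v \<noteq> v"
      "other (?E `` {u}) (other (?E `` {u}) v) = v" if "(u, v) \<in> ?E" for u v
    using other_props[of "?E `` {u}" v] out[of u] that sub by auto
  have \<beta>: "(other (?E\<inverse> `` {v}) u, v) \<in> ?E" "other (?E\<inverse> `` {v}) u \<noteq> u"
      "other (?E\<inverse> `` {v}) (other (?E\<inverse> `` {v}) u) = u" if "(u, v) \<in> ?E" for u v
    using other_props[of "?E\<inverse> `` {v}" u] indeg[of v] that sub by auto
  have invol: "\<alpha> (\<alpha> e) = e" "\<beta> (\<beta> e) = e" for e
    using \<alpha> \<beta> by (cases e; simp add: \<alpha>_def \<beta>_def)+
  have finE: "finite ?E"
    using fin sub by (auto intro: finite_subset)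
  have "\<alpha> permutes ?E"
  proof (rule inj_imp_permutes[OF _ finE])
    show "inj_on \<alpha> ?E" by (rule inj_on_inverseI) (rule invol)
  qed (auto simp: \<alpha>_def \<alpha>)
  moreover have "\<beta> permutes ?E"
  proof (rule inj_imp_permutes[OF _ finE])
    show "inj_on \<beta> ?E" by (rule inj_on_inverseI) (rule invol)
  qed (auto simp: \<beta>_def \<beta>)
  moreover have "\<alpha> e \<noteq> e" "\<beta> e \<noteq> e" if "e \<in> ?E" for e
    using that \<alpha> \<beta> by (cases e; auto simp: \<alpha>_def \<beta>_def)+
  ultimately obtain S where
    S\<alpha>: "\<And>e. e \<in> ?E \<Longrightarrow> \<alpha> e \<in> S \<longleftrightarrow> e \<notin> S" and S\<beta>: "\<And>e. e \<in> ?E \<Longrightarrow> \<beta> e \<in> S \<longleftrightarrow> e \<notin> S"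
    using ex_alternating_set[OF finE, of \<alpha> \<beta>] invol by metis
  have "\<exists>w. (v, w) \<in> ?E \<and> (v, w) \<in> S" if "v \<in> ?V" for v
  proof -
    have "?E `` {v} \<noteq> {}"
      using out[OF that] by auto
    then obtain w where w: "(v, w) \<in> ?E"
      by blast
    show ?thesis
      using S\<alpha>[OF w] \<alpha>(1)[OF w] w by (cases "(v, w) \<in> S") (auto simp: \<alpha>_def)
  qed
  then obtain f where f: "\<And>v. v \<in> ?V \<Longrightarrow> (v, f v) \<in> ?E \<and> (v, f v) \<in> S"
    by metis
  define \<sigma> where "\<sigma> v = (if v \<in> ?V then f v else v)" for v
  have "inj_on \<sigma> ?V"
  proof (rule inj_onI, rule ccontr)
    fix u v assume uv: "u \<in> ?V" "v \<in> ?V" "\<sigma> u = \<sigma> v" "u \<noteq> v"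
    let ?w = "\<sigma> u"
    have arcs: "(u, ?w) \<in> ?E" "(v, ?w) \<in> ?E" "(u, ?w) \<in> S" "(v, ?w) \<in> S"
      using f[of u] f[of v] uv by (auto simp: \<sigma>_def)
    then have "v = other (?E\<inverse> `` {?w}) u"
      using other_eq_iff[of "?E\<inverse> `` {?w}" u v] indeg[of ?w] sub uv(4) by auto
    then have "\<beta> (u, ?w) = (v, ?w)"
      using arcs(1) by (simp add: \<beta>_def)
    then show False
      using S\<beta>[OF arcs(1)] arcs by simp
  qed
  then have "\<sigma> permutes ?V"
  proof (rule inj_imp_permutes[OF _ fin])
    show "\<sigma> v \<in> ?V" if "v \<in> ?V" for v
      using f[OF that] that sub by (auto simp: \<sigma>_def)
  qed (simp add: \<sigma>_def)
  then have "\<sigma> \<in> cycle_factors G"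
    using f by (simp add: cycle_factors_def \<sigma>_def)
  then show ?thesis by blast
qed

section \<open>The opposite cycle-factor\<close>

definition opposite :: "'a pair_pre_digraph \<Rightarrow> ('a \<Rightarrow> 'a) \<Rightarrow> 'a \<Rightarrow> 'a" where
  "opposite G \<sigma> v = (if v \<in> pverts G then other (parcs G `` {v}) (\<sigma> v) else v)"

lemma opposite_props:
  assumes "regular_digraph 2 G" "\<sigma> \<in> cycle_factors G" "v \<in> pverts G"
  shows "parcs G `` {v} = {\<sigma> v, opposite G \<sigma> v}" "opposite G \<sigma> v \<noteq> \<sigma> v"
proof -
  have "card (parcs G `` {v}) = 2" "\<sigma> v \<in> parcs G `` {v}"
    using assms by (auto simp: regular_digraph_iff cycle_factors_def)
  note other = other_props[OF this]
  have "opposite G \<sigma> v = other (parcs G `` {v}) (\<sigma> v)"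
    using assms(3) by (simp add: opposite_def)
  then show "parcs G `` {v} = {\<sigma> v, opposite G \<sigma> v}" "opposite G \<sigma> v \<noteq> \<sigma> v"
    using other(2,4) by metis+
qed

text \<open>
  If two vertices \<open>u\<close>, \<open>v\<close> had the same image \<open>w\<close> under the opposite, then \<open>w\<close> would have three
  in-neighbours: \<open>u\<close>, \<open>v\<close> and its preimage under \<open>\<sigma>\<close>.
\<close>

lemma opposite_cycle_factor:
  assumes reg: "regular_digraph 2 G" and \<sigma>: "\<sigma> \<in> cycle_factors G"
  shows "opposite G \<sigma> \<in> cycle_factors G"
proof -
  let ?V = "pverts G" and ?E = "parcs G" and ?\<tau> = "opposite G \<sigma>"
  have fin: "finite ?V" and sub: "?E \<subseteq> ?V \<times> ?V"
    and indeg: "\<And>v. v \<in> ?V \<Longrightarrow> card (?E\<inverse> `` {v}) = 2"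
    using reg by (auto simp: regular_digraph_iff)
  have perm: "\<sigma> permutes ?V" and arc: "\<And>v. v \<in> ?V \<Longrightarrow> (v, \<sigma> v) \<in> ?E"
    using \<sigma> by (auto simp: cycle_factors_def)
  have arc': "(v, ?\<tau> v) \<in> ?E" if "v \<in> ?V" for v
    using opposite_props(1)[OF reg \<sigma> that] by blast
  have "inj_on ?\<tau> ?V"
  proof (rule inj_onI, rule ccontr)
    fix u v assume uv: "u \<in> ?V" "v \<in> ?V" "?\<tau> u = ?\<tau> v" "u \<noteq> v"
    let ?w = "?\<tau> u"
    have w: "?w \<in> ?V"
      using arc'[OF uv(1)] sub by blast
    then obtain x where x: "x \<in> ?V" "\<sigma> x = ?w"
      using permutes_image[OF perm] by (metis imageE)
    have "x \<noteq> u" "x \<noteq> v"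
      using x uv opposite_props(2)[OF reg \<sigma>] by metis+
    then have "card {x, u, v} = 3"
      using uv(4) by simp
    moreover have "{x, u, v} \<subseteq> ?E\<inverse> `` {?w}"
      using arc[OF x(1)] arc'[OF uv(1)] arc'[OF uv(2)] x(2) uv(3) by simp
    moreover have "finite (?E\<inverse> `` {?w})"
      using indeg[OF w] by (simp add: card_ge_0_finite)
    ultimately show False
      using indeg[OF w] card_mono[of "?E\<inverse> `` {?w}" "{x, u, v}"] by linarith
  qed
  then have "?\<tau> permutes ?V"
  proof (rule inj_imp_permutes[OF _ fin])
    show "?\<tau> v \<in> ?V" if "v \<in> ?V" for v
      using arc'[OF that] sub by blast
  qed (simp add: opposite_def)
  then show ?thesis
    using arc' by (simp add: cycle_factors_def)
qed

lemma opposite_opposite: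
  assumes "regular_digraph 2 G" "\<sigma> \<in> cycle_factors G"
  shows "opposite G (opposite G \<sigma>) = \<sigma>"
proof
  fix v
  show "opposite G (opposite G \<sigma>) v = \<sigma> v"
  proof (cases "v \<in> pverts G")
    case True
    then show ?thesis
      using opposite_props[OF assms True]
        opposite_props[OF assms(1) opposite_cycle_factor[OF assms] True]
      by (auto simp: doubleton_eq_iff)
  next
    case False
    then show ?thesis
      using assms(2) by (simp add: opposite_def cycle_factors_def permutes_def)
  qed
qed

section \<open>Counting cycles vertex by vertex\<close>

lemma num_cycles_eq_sum:
  assumes "finite V" "\<sigma> permutes V"
  shows "real (num_cycles V \<sigma>) = (\<Sum>v\<in>V. 1 / real (card (orbit \<sigma> v)))"
proof -
  have perm: "permutation \<sigma>"
    using assms by (auto simp: permutation_permutes)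
  have "(\<Sum>v\<in>V. 1 / real (card (orbit \<sigma> v)))
      = (\<Sum>C\<in>orbit \<sigma> ` V. \<Sum>v | v \<in> V \<and> orbit \<sigma> v = C. 1 / real (card (orbit \<sigma> v)))"
    by (rule sum.image_gen[OF assms(1)])
  also have "\<dots> = (\<Sum>C\<in>orbit \<sigma> ` V. 1)"
  proof (rule sum.cong[OF refl])
    fix C assume "C \<in> orbit \<sigma> ` V"
    then obtain w where w: "w \<in> V" "C = orbit \<sigma> w"
      by blast
    have "{v. v \<in> V \<and> orbit \<sigma> v = C} = C"
      using permutes_orbit_subset[OF assms(2) w(1)] permutation_self_in_orbit[OF perm]
        orbit_cyclic_eq3[OF cyclic_on_orbit'[OF perm]] w(2) by blast
    moreover have "card C \<noteq> 0"
      using finite_orbit[OF permutation_self_in_orbit[OF perm]] orbit_nonempty w(2)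
      by (metis card_0_eq)
    moreover have "(\<Sum>v | v \<in> V \<and> orbit \<sigma> v = C. 1 / real (card (orbit \<sigma> v)))
        = (\<Sum>v | v \<in> V \<and> orbit \<sigma> v = C. 1 / real (card C))"
      by (rule sum.cong) auto
    ultimately show "(\<Sum>v | v \<in> V \<and> orbit \<sigma> v = C. 1 / real (card (orbit \<sigma> v))) = 1"
      by simp
  qed
  finally show ?thesis
    by (simp add: num_cycles_def)
qed

lemma card_orbit_not_fixed:
  assumes "permutation \<sigma>" "\<sigma> v \<noteq> v"
  shows "2 \<le> card (orbit \<sigma> v)" "card (orbit \<sigma> v) = 2 \<longleftrightarrow> \<sigma> (\<sigma> v) = v"
proof -
  have v: "v \<in> orbit \<sigma> v"
    by (rule permutation_self_in_orbit[OF assms(1)])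
  have fin: "finite (orbit \<sigma> v)"
    by (rule finite_orbit[OF v])
  have two: "card {v, \<sigma> v} = 2" and sub: "{v, \<sigma> v} \<subseteq> orbit \<sigma> v"
    using assms(2) v orbit.base[of \<sigma> v] by auto
  show "2 \<le> card (orbit \<sigma> v)"
    using card_mono[OF fin sub] two by simp
  show "card (orbit \<sigma> v) = 2 \<longleftrightarrow> \<sigma> (\<sigma> v) = v"
  proof
    assume "card (orbit \<sigma> v) = 2"
    then have "{v, \<sigma> v} = orbit \<sigma> v"
      using card_seteq[OF fin sub] two by simp
    then have "\<sigma> (\<sigma> v) \<in> {v, \<sigma> v}"
      by (metis orbit.base orbit.step)
    moreover have "\<sigma> (\<sigma> v) \<noteq> \<sigma> v"
      using assms permutation_bijective[OF assms(1)] by (metis bij_inv_eq_iff)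
    ultimately show "\<sigma> (\<sigma> v) = v" by simp
  next
    assume closed: "\<sigma> (\<sigma> v) = v"
    have "y \<in> {v, \<sigma> v}" if "y \<in> orbit \<sigma> v" for y
      using that by induction (auto simp: closed)
    with sub have "orbit \<sigma> v = {v, \<sigma> v}" by blast
    then show "card (orbit \<sigma> v) = 2" using two by simp
  qed
qed

text \<open>
  The local form of the bound: at most one of the two permutations fixes \<open>v\<close>, contributing \<open>1\<close>,
  and any other contribution is at most \<open>1/2\<close>.
\<close>

lemma inverse_orbits_le:
  assumes "permutation \<sigma>" "permutation \<tau>" "\<tau> v \<noteq> \<sigma> v"
  shows "1 / real (card (orbit \<sigma> v)) + 1 / real (card (orbit \<tau> v)) \<le> 3 / 2"
    and "1 / real (card (orbit \<sigma> v)) + 1 / real (card (orbit \<tau> v)) = 3 / 2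
      \<longleftrightarrow> \<sigma> v = v \<and> \<tau> (\<tau> v) = v \<or> \<tau> v = v \<and> \<sigma> (\<sigma> v) = v"
proof -
  let ?r = "\<lambda>\<rho>. 1 / real (card (orbit \<rho> v))"
  have fixed: "?r \<rho> = 1" if "\<rho> v = v" for \<rho>
    using that by (simp flip: orbit_eq_singleton_iff)
  have moved: "?r \<rho> \<le> 1 / 2" "?r \<rho> = 1 / 2 \<longleftrightarrow> \<rho> (\<rho> v) = v"
    if "permutation \<rho>" "\<rho> v \<noteq> v" for \<rho>
    using card_orbit_not_fixed[OF that] by (auto simp: field_simps)
  show "?r \<sigma> + ?r \<tau> \<le> 3 / 2"
    using fixed[of \<sigma>] fixed[of \<tau>] moved(1)[OF assms(1)] moved(1)[OF assms(2)] assms(3)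
    by (cases "\<sigma> v = v"; cases "\<tau> v = v") auto
  show "?r \<sigma> + ?r \<tau> = 3 / 2 \<longleftrightarrow> \<sigma> v = v \<and> \<tau> (\<tau> v) = v \<or> \<tau> v = v \<and> \<sigma> (\<sigma> v) = v"
  proof (cases "\<sigma> v = v")
    case True
    then show ?thesis
      using fixed[of \<sigma>] moved(2)[OF assms(2)] assms(3) by auto
  next
    case \<sigma>: False
    show ?thesis
    proof (cases "\<tau> v = v")
      case True
      then show ?thesis
        using fixed[of \<tau>] moved(2)[OF assms(1) \<sigma>] \<sigma> by auto
    next
      case False
      then show ?thesis
        using moved(1)[OF assms(1) \<sigma>] moved(1)[OF assms(2) False] \<sigma> by auto
    qed
  qed
qed

section \<open>The expected number of cycles\<close>

text \<open>
  The equality case does not depend on \<open>\<sigma>\<close>, so the average attains the bound as soon as one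
  opposite pair does. In the equality case, transitivity of the arc relation comes from
  reflexivity and symmetry: if \<open>(u, v)\<close> is an arc with \<open>u \<noteq> v\<close>, then \<open>u\<close> and \<open>v\<close> are already the two
  out-neighbours of \<open>v\<close>. Conversely, in an equivalence relation \<open>{\<sigma> v, \<sigma>' v}\<close> is the class of
  \<open>v\<close>; the permutation that moves \<open>v\<close> has to swap the two points of this class.
\<close>

lemma num_cycles_add_opposite:
  assumes reg: "regular_digraph 2 G" and \<sigma>: "\<sigma> \<in> cycle_factors G"
  defines "c \<equiv> \<lambda>\<rho>. real (num_cycles (pverts G) \<rho>)"
  shows "c \<sigma> + c (opposite G \<sigma>) \<le> 3 / 2 * real (card (pverts G))"
    and "c \<sigma> + c (opposite G \<sigma>) = 3 / 2 * real (card (pverts G)) \<longleftrightarrow> equiv (pverts G) (parcs G)"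
proof -
  let ?V = "pverts G" and ?E = "parcs G"
  define \<tau> where "\<tau> = opposite G \<sigma>"
  have fin: "finite ?V" and sub: "?E \<subseteq> ?V \<times> ?V"
    using reg by (auto simp: regular_digraph_iff)
  have perm: "\<sigma> permutes ?V" "\<tau> permutes ?V"
    using \<sigma> opposite_cycle_factor[OF reg \<sigma>] by (auto simp: cycle_factors_def \<tau>_def)
  then have perm': "permutation \<sigma>" "permutation \<tau>"
    using fin by (auto simp: permutation_permutes)
  have out: "?E `` {v} = {\<sigma> v, \<tau> v}" and ne: "\<tau> v \<noteq> \<sigma> v" if "v \<in> ?V" for v
    using opposite_props[OF reg \<sigma> that] by (auto simp: \<tau>_def)
  let ?s = "\<lambda>v. 1 / real (card (orbit \<sigma> v)) + 1 / real (card (orbit \<tau> v))"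
  let ?P = "\<lambda>v. \<sigma> v = v \<and> \<tau> (\<tau> v) = v \<or> \<tau> v = v \<and> \<sigma> (\<sigma> v) = v"
  have c_eq: "c \<sigma> + c \<tau> = (\<Sum>v\<in>?V. ?s v)"
    using num_cycles_eq_sum[OF fin perm(1)] num_cycles_eq_sum[OF fin perm(2)]
    by (simp add: c_def sum.distrib)
  have le: "?s v \<le> 3 / 2" if "v \<in> ?V" for v
    by (rule inverse_orbits_le(1)[OF perm' ne[OF that]])
  have const: "(\<Sum>v\<in>?V. 3 / 2) = 3 / 2 * real (card ?V)"
    by simp
  show "c \<sigma> + c (opposite G \<sigma>) \<le> 3 / 2 * real (card ?V)"
    unfolding \<tau>_def[symmetric] c_eq const[symmetric] by (rule sum_mono) (rule le)
  have "c \<sigma> + c \<tau> = 3 / 2 * real (card ?V) \<longleftrightarrow> (\<Sum>v\<in>?V. 3 / 2 - ?s v) = 0"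
    unfolding c_eq const[symmetric] sum_subtractf by auto
  also have "\<dots> \<longleftrightarrow> (\<forall>v\<in>?V. 3 / 2 - ?s v = 0)"
    by (rule sum_nonneg_eq_0_iff[OF fin]) (use le in force)
  also have "\<dots> \<longleftrightarrow> (\<forall>v\<in>?V. ?P v)"
    using inverse_orbits_le(2)[OF perm' ne] by (intro ball_cong) auto
  also have "\<dots> \<longleftrightarrow> equiv ?V ?E"
  proof
    assume P: "\<forall>v\<in>?V. ?P v"
    have refl: "(v, v) \<in> ?E" if "v \<in> ?V" for v
      using P that out[OF that] by (metis Image_singleton_iff insertCI)
    have sym: "(w, v) \<in> ?E" if vw: "(v, w) \<in> ?E" for v w
    proof -
      have V: "v \<in> ?V" "w \<in> ?V" using vw sub by auto
      then have "w = \<sigma> v \<or> w = \<tau> v" using out[of v] vw by blast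
      then have "v \<in> {\<sigma> w, \<tau> w}" using P V(1) by auto
      then show ?thesis using out[OF V(2)] by blast
    qed
    have trans: "(u, w) \<in> ?E" if uv: "(u, v) \<in> ?E" and vw: "(v, w) \<in> ?E" for u v w
    proof (cases "u = v")
      case False
      have V: "u \<in> ?V" "v \<in> ?V" using uv sub by auto
      have "u \<in> {\<sigma> v, \<tau> v}" "v \<in> {\<sigma> v, \<tau> v}" "w \<in> {\<sigma> v, \<tau> v}"
        using sym[OF uv] refl[OF V(2)] vw out[OF V(2)] by blast+
      then have "w = u \<or> w = v" using False by auto
      then show ?thesis using refl[OF V(1)] uv by blast
    qed (use vw in simp)
    show "equiv ?V ?E"
      by (intro equivI refl_onI symI transI) (fact sub, fact refl, fact sym, fact trans)
  next
    assume eq: "equiv ?V ?E"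
    show "\<forall>v\<in>?V. ?P v"
    proof
      fix v assume v: "v \<in> ?V"
      have same: "?E `` {w} = {\<sigma> v, \<tau> v}" if "w \<in> {\<sigma> v, \<tau> v}" for w
        using equiv_class_eq[OF eq, of v w] out[OF v] that by blast
      have in_V: "w \<in> ?V" if "w \<in> {\<sigma> v, \<tau> v}" for w
        using out[OF v] sub that by blast
      have "v \<in> {\<sigma> v, \<tau> v}"
        using equiv_class_self[OF eq v] out[OF v] by blast
      then show "?P v"
        using same[of "\<sigma> v"] same[of "\<tau> v"] out[OF in_V[of "\<sigma> v"]] out[OF in_V[of "\<tau> v"]] ne[OF v]
          permutes_inj[OF perm(1)] permutes_inj[OF perm(2)]
        by (auto simp: doubleton_eq_iff dest: injD)
    qed
  qed
  finally show "c \<sigma> + c (opposite G \<sigma>) = 3 / 2 * real (card ?V) \<longleftrightarrow> equiv ?V ?E"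
    by (simp add: \<tau>_def)
qed

lemma expected_cycles_le:
  assumes reg: "regular_digraph 2 G"
  shows "expected_cycles G \<le> 3 * real (card (pverts G)) / 4"
    and "expected_cycles G = 3 * real (card (pverts G)) / 4 \<longleftrightarrow> equiv (pverts G) (parcs G)"
proof -
  let ?CF = "cycle_factors G" and ?c = "\<lambda>\<rho>. real (num_cycles (pverts G) \<rho>)"
  let ?n = "real (card (pverts G))"
  have "?CF \<subseteq> {\<sigma>. \<sigma> permutes pverts G}"
    by (auto simp: cycle_factors_def)
  then have fin: "finite ?CF"
    by (rule finite_subset) (use reg in \<open>simp add: finite_permutations regular_digraph_iff\<close>)
  have ne: "?CF \<noteq> {}"
    by (rule cycle_factors_nonempty[OF reg])
  have pos: "real (card ?CF) > 0"
    using fin ne by (simp add: card_gt_0_iff)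
  have "(\<Sum>\<sigma>\<in>?CF. ?c (opposite G \<sigma>)) = (\<Sum>\<sigma>\<in>?CF. ?c \<sigma>)"
    by (rule sum.reindex_bij_witness[of _ "opposite G" "opposite G"])
      (auto simp: opposite_opposite[OF reg] opposite_cycle_factor[OF reg])
  moreover have "expected_cycles G = (\<Sum>\<sigma>\<in>?CF. ?c \<sigma>) / real (card ?CF)"
    unfolding expected_cycles_def by (rule integral_pmf_of_set[OF ne fin])
  ultimately have avg: "expected_cycles G = (\<Sum>\<sigma>\<in>?CF. ?c \<sigma> + ?c (opposite G \<sigma>)) / (2 * real (card ?CF))"
    by (simp add: sum.distrib)
  have const: "3 * ?n / 4 = (\<Sum>\<sigma>\<in>?CF. 3 / 2 * ?n) / (2 * real (card ?CF))"
    using pos by (simp add: field_simps)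
  show "expected_cycles G \<le> 3 * ?n / 4"
    unfolding avg const using pos
    by (intro divide_right_mono sum_mono num_cycles_add_opposite(1)[OF reg]) auto
  show "expected_cycles G = 3 * ?n / 4 \<longleftrightarrow> equiv (pverts G) (parcs G)"
  proof
    assume "equiv (pverts G) (parcs G)"
    then have "(\<Sum>\<sigma>\<in>?CF. ?c \<sigma> + ?c (opposite G \<sigma>)) = (\<Sum>\<sigma>\<in>?CF. 3 / 2 * ?n)"
      using num_cycles_add_opposite(2)[OF reg] by (intro sum.cong) auto
    then show "expected_cycles G = 3 * ?n / 4"
      unfolding avg const by (rule arg_cong)
  next
    assume eq: "expected_cycles G = 3 * ?n / 4"
    show "equiv (pverts G) (parcs G)"
    proof (rule ccontr)
      assume "\<not> ?thesis"
      then have "?c \<sigma> + ?c (opposite G \<sigma>) < 3 / 2 * ?n" if "\<sigma> \<in> ?CF" for \<sigma>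
        using num_cycles_add_opposite[OF reg that] by linarith
      then have "(\<Sum>\<sigma>\<in>?CF. ?c \<sigma> + ?c (opposite G \<sigma>)) < (\<Sum>\<sigma>\<in>?CF. 3 / 2 * ?n)"
        by (intro sum_strict_mono fin ne)
      then show False
        using eq pos unfolding avg const by (simp add: field_simps)
    qed
  qed
qed

section \<open>Disjoint unions of complete looped digraphs\<close>

lemma digraph_iso_with_proj_iff:
  assumes "parcs G \<subseteq> pverts G \<times> pverts G"
  shows "digraph_iso (with_proj G) (with_proj H)
    \<longleftrightarrow> (\<exists>f. bij_betw f (pverts G) (pverts H) \<and> parcs H = map_prod f f ` parcs G)"
proof
  assume "digraph_iso (with_proj G) (with_proj H)"
  then obtain h where h: "pre_digraph.digraph_isomorphism (with_proj G) h"
      and H: "with_proj H = app_iso h (with_proj G)"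
    unfolding digraph_iso_def by blast
  have "inj_on (iso_verts h) (pverts G)"
    using pre_digraph.digraph_isomorphism_inj_on_verts[OF h] by simp
  moreover have "pverts H = iso_verts h ` pverts G"
    using arg_cong[OF H, of verts] by simp
  moreover have "parcs H = map_prod (iso_verts h) (iso_verts h) ` parcs G"
    using wf_digraph.arcs_ends_app_iso_eq[OF _ h] h arg_cong[OF H, of arcs_ends]
    by (simp add: map_prod_def pre_digraph.digraph_isomorphism_def)
  ultimately show "\<exists>f. bij_betw f (pverts G) (pverts H) \<and> parcs H = map_prod f f ` parcs G"
    by (auto simp: bij_betw_def)
next
  assume "\<exists>f. bij_betw f (pverts G) (pverts H) \<and> parcs H = map_prod f f ` parcs G"
  then obtain f where f: "bij_betw f (pverts G) (pverts H)" "parcs H = map_prod f f ` parcs G"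
    by blast
  define h where "h = \<lparr>iso_verts = f, iso_arcs = map_prod f f, iso_head = snd, iso_tail = fst\<rparr>"
  have "inj_on (map_prod f f) (parcs G)"
    using map_prod_inj_on[OF bij_betw_imp_inj_on[OF f(1)] bij_betw_imp_inj_on[OF f(1)]] assms
    by (rule inj_on_subset)
  moreover have "wf_digraph (with_proj G)"
    by unfold_locales (use assms in auto)
  ultimately have "pre_digraph.digraph_isomorphism (with_proj G) h"
    using bij_betw_imp_inj_on[OF f(1)]
    by (auto simp: pre_digraph.digraph_isomorphism_def h_def)
  moreover have "with_proj H = app_iso h (with_proj G)"
    using f by (simp add: with_proj_def app_iso_def h_def bij_betw_def)
  ultimately show "digraph_iso (with_proj G) (with_proj H)"
    unfolding digraph_iso_def by blast
qed

lemma disjoint_copies_complete_simps: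
  "pverts (disjoint_copies k (complete_looped d)) = {..<k} \<times> {..<d}"
  "parcs (disjoint_copies k (complete_looped d))
    = {(x, y). x \<in> {..<k} \<times> {..<d} \<and> y \<in> {..<k} \<times> {..<d} \<and> fst x = fst y}"
  by (auto simp: disjoint_copies_def complete_looped_def)

lemma regular_disjoint_copies_complete:
  "regular_digraph d (disjoint_copies k (complete_looped d))"
proof -
  let ?E = "parcs (disjoint_copies k (complete_looped d))"
  have "?E `` {x} = {fst x} \<times> {..<d}" "?E\<inverse> `` {x} = {fst x} \<times> {..<d}"
    if "x \<in> {..<k} \<times> {..<d}" for x
    using that by (auto simp: disjoint_copies_complete_simps)
  then have "card (?E `` {x}) = d \<and> card (?E\<inverse> `` {x}) = d" if "x \<in> {..<k} \<times> {..<d}" for x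
    using that by (simp add: card_cartesian_product)
  then show ?thesis
    unfolding regular_digraph_iff by (auto simp: disjoint_copies_complete_simps)
qed

lemma equiv_disjoint_copies_complete:
  "equiv (pverts (disjoint_copies k (complete_looped d))) (parcs (disjoint_copies k (complete_looped d)))"
  unfolding disjoint_copies_complete_simps
  by (intro equivI refl_onI symI transI) auto

text \<open>
  In a \<open>d\<close>-regular digraph whose arcs form an equivalence relation, the classes are the
  out-neighbourhoods and have \<open>d\<close> elements, so there are \<open>k\<close> of them. An isomorphism sends \<open>v\<close> to
  the number of its class and the number of \<open>v\<close> within the class.
\<close>

lemma equiv_regular_iff_iso:
  assumes reg: "regular_digraph d G" and card: "card (pverts G) = k * d" and "d > 0"
  shows "equiv (pverts G) (parcs G)
    \<longleftrightarrow> digraph_iso (with_proj G) (with_proj (disjoint_copies k (complete_looped d)))"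
proof -
  let ?V = "pverts G" and ?E = "parcs G" and ?M = "disjoint_copies k (complete_looped d)"
  have fin: "finite ?V" and sub: "?E \<subseteq> ?V \<times> ?V" and out: "\<And>v. v \<in> ?V \<Longrightarrow> card (?E `` {v}) = d"
    using reg by (auto simp: regular_digraph_iff)
  note iso_iff = digraph_iso_with_proj_iff[OF sub, of ?M]
  show ?thesis
  proof
    assume eq: "equiv ?V ?E"
    have class_card: "card C = d" if "C \<in> ?V // ?E" for C
      using that out by (auto elim!: quotientE)
    have finq: "finite (?V // ?E)"
      using finite_quotient[OF fin] eq by (simp add: equiv_def)
    have "d * card (?V // ?E) = card (\<Union>(?V // ?E))"
      using finq quotient_disj[OF eq] class_card Union_quotient[OF eq] fin
      by (intro card_partition) auto
    then have "card (?V // ?E) = k"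
      using card \<open>d > 0\<close> by (simp add: Union_quotient[OF eq])
    then obtain h where h: "bij_betw h (?V // ?E) {..<k}"
      using finq ex_bij_betw_finite_nat[OF finq] by (auto simp: atLeast0LessThan)
    have "\<exists>g. bij_betw g C {..<d}" if "C \<in> ?V // ?E" for C
    proof -
      have "finite C"
        using class_card[OF that] \<open>d > 0\<close> by (simp add: card_ge_0_finite)
      then show ?thesis
        using ex_bij_betw_finite_nat[of C] class_card[OF that] by (auto simp: atLeast0LessThan)
    qed
    then obtain g where g: "\<And>C. C \<in> ?V // ?E \<Longrightarrow> bij_betw (g C) C {..<d}"
      by metis
    define f where "f v = (h (?E `` {v}), g (?E `` {v}) v)" for v
    have cls: "?E `` {v} \<in> ?V // ?E" "v \<in> ?E `` {v}" if "v \<in> ?V" for v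
      using that equiv_class_self[OF eq that] by (auto intro: quotientI)
    have f_in: "f v \<in> {..<k} \<times> {..<d}" if "v \<in> ?V" for v
      using bij_betwE[OF h] bij_betwE[OF g] cls[OF that] unfolding f_def by blast
    have fst_f: "fst (f u) = fst (f v) \<longleftrightarrow> (u, v) \<in> ?E" if "u \<in> ?V" "v \<in> ?V" for u v
    proof -
      have "fst (f u) = fst (f v) \<longleftrightarrow> ?E `` {u} = ?E `` {v}"
        using inj_on_eq_iff[OF bij_betw_imp_inj_on[OF h]] cls that by (simp add: f_def)
      then show ?thesis
        using eq_equiv_class_iff[OF eq that] by simp
    qed
    have inj: "inj_on f ?V"
    proof (rule inj_onI)
      fix u v assume uv: "u \<in> ?V" "v \<in> ?V" "f u = f v"
      have same: "?E `` {u} = ?E `` {v}"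
        using fst_f[OF uv(1,2)] uv(3) eq_equiv_class_iff[OF eq uv(1,2)] by simp
      then have "g (?E `` {u}) u = g (?E `` {u}) v"
        using uv(3) by (simp add: f_def)
      then show "u = v"
        using inj_onD[OF bij_betw_imp_inj_on[OF g[OF cls(1)[OF uv(1)]]]] cls(2)[OF uv(1)]
          cls(2)[OF uv(2)] same by blast
    qed
    have img: "f ` ?V = {..<k} \<times> {..<d}"
    proof (rule card_subset_eq)
      show "f ` ?V \<subseteq> {..<k} \<times> {..<d}"
        using f_in by blast
      show "card (f ` ?V) = card ({..<k} \<times> {..<d})"
        using card card_image[OF inj] by (simp add: card_cartesian_product)
    qed simp
    have "map_prod f f ` ?E = parcs ?M"
    proof
      have "(f u, f v) \<in> parcs ?M" if "(u, v) \<in> ?E" for u v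
      proof -
        have "u \<in> ?V" "v \<in> ?V" using that sub by auto
        then show ?thesis
          using f_in[of u] f_in[of v] fst_f[of u v] that
          by (simp add: disjoint_copies_complete_simps)
      qed
      then show "map_prod f f ` ?E \<subseteq> parcs ?M"
        by auto
      show "parcs ?M \<subseteq> map_prod f f ` ?E"
      proof
        fix e assume "e \<in> parcs ?M"
        then have "fst e \<in> f ` ?V" "snd e \<in> f ` ?V" and fs: "fst (fst e) = fst (snd e)"
          unfolding img by (auto simp: disjoint_copies_complete_simps)
        then obtain u v where "u \<in> ?V" "v \<in> ?V" "fst e = f u" "snd e = f v"
          by blast
        then have "(u, v) \<in> ?E" "e = map_prod f f (u, v)"
          using fst_f[of u v] fs by (simp_all add: prod_eq_iff)
        then show "e \<in> map_prod f f ` ?E" by blast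
      qed
    qed
    then show "digraph_iso (with_proj G) (with_proj ?M)"
      unfolding iso_iff using inj img
      by (intro exI[of _ f]) (simp add: bij_betw_def disjoint_copies_complete_simps(1))
  next
    assume "digraph_iso (with_proj G) (with_proj ?M)"
    then obtain f where f: "bij_betw f ?V (pverts ?M)" "parcs ?M = map_prod f f ` ?E"
      unfolding iso_iff by blast
    have arc_iff: "(u, v) \<in> ?E \<longleftrightarrow> (f u, f v) \<in> parcs ?M" if "u \<in> ?V" "v \<in> ?V" for u v
    proof
      assume "(f u, f v) \<in> parcs ?M"
      then obtain x y where xy: "(x, y) \<in> ?E" "f x = f u" "f y = f v"
        unfolding f(2) by (auto simp: image_iff)
      then have "x = u" "y = v"
        using inj_onD[OF bij_betw_imp_inj_on[OF f(1)]] that sub by blast+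
      with xy(1) show "(u, v) \<in> ?E" by simp
    qed (auto simp: f(2) intro: rev_image_eqI)
    have "f v \<in> pverts ?M" if "v \<in> ?V" for v
      using bij_betwE[OF f(1)] that by blast
    then have arc_fst: "(u, v) \<in> ?E \<longleftrightarrow> fst (f u) = fst (f v)" if "u \<in> ?V" "v \<in> ?V" for u v
      using that unfolding arc_iff[OF that] by (auto simp: disjoint_copies_complete_simps)
    have "?E = {(u, v). u \<in> ?V \<and> v \<in> ?V \<and> fst (f u) = fst (f v)}"
      using arc_fst sub by auto
    then show "equiv ?V ?E"
      by (simp only:) (intro equivI refl_onI symI transI; auto)
  qed
qed

theorem mainTheorem2:
  fixes n :: nat
  defines "M \<equiv> disjoint_copies (n div 2) (complete_looped 2)"
  assumes "n > 0" and "even n"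
  shows "regular_digraph 2 M \<and> card (pverts M) = n
    \<and> expected_cycles M = real n / 2 * harm 2
    \<and> real n / 2 * harm 2 = 3 * real n / 4
    \<and> (\<forall>G :: 'a pair_pre_digraph. regular_digraph 2 G \<and> card (pverts G) = n \<longrightarrow>
         expected_cycles G \<le> expected_cycles M
         \<and> (expected_cycles G = expected_cycles M \<longleftrightarrow> digraph_iso (with_proj G) (with_proj M)))"
proof -
  have n: "n div 2 * 2 = n"
    using \<open>even n\<close> by simp
  have reg: "regular_digraph 2 M"
    unfolding M_def by (rule regular_disjoint_copies_complete)
  have card: "card (pverts M) = n"
    using n by (simp add: M_def disjoint_copies_complete_simps(1) card_cartesian_product)
  have "harm 2 = (3 / 2 :: real)"
    by (simp add: harm_def numeral_2_eq_2)
  then have harm: "real n / 2 * harm 2 = 3 * real n / 4"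
    by simp
  have exp: "expected_cycles M = 3 * real n / 4"
    using expected_cycles_le(2)[OF reg] card equiv_disjoint_copies_complete by (simp add: M_def)
  have "expected_cycles G \<le> expected_cycles M
      \<and> (expected_cycles G = expected_cycles M \<longleftrightarrow> digraph_iso (with_proj G) (with_proj M))"
    if "regular_digraph 2 G" "card (pverts G) = n" for G :: "'a pair_pre_digraph"
    using expected_cycles_le[OF that(1)] equiv_regular_iff_iso[OF that(1), of "n div 2"] that(2) exp n
    unfolding M_def by auto
  then show ?thesis
    unfolding harm using reg card exp by blast
qed

end
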